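(* Let $\mathcal{S}=\langle S,\cdot,{}^*\rangle$ be a finite involutory semigroup such that the $3$-element twisted semilattice $\mathcal{TSL}$ belongs to the variety $\mathsf{var}\,\mathcal{S}$ of unary semigroups generated by $\mathcal{S}$. If the semigroup reduct $\langle S,\cdot\rangle$ is inherently nonfinitely based (as a plain semigroup), then $\mathcal{S}$ is inherently nonfinitely based (as a unary semigroup).
   Context: A unary semigroup is a semigroup endowed with an additional unary operation $x\mapsto x^*$; its (semigroup) reduct is the plain semigroup $\langle S,\cdot\rangle$ obtained by forgetting the unary operation. A unary semigroup $\langle S,\cdot,{}^*\rangle$ is an involutory semigroup if it satisfies the identities $(xy)^*=y^*x^*$ and $(x^* )^*=x$. Varieties of plain semigroups are taken in the signature $\{\cdot\}$ and varieties of unary semigroups in the signature $\{\cdot,{}^*\}$; $\mathsf{var}\,\mathcal{S}$ is the variety generated by $\mathcal{S}$. A variety is finitely based if it can be defined by a finite set of identities (in its signature). A variety is locally finite if each of its finitely generated members is finite. A finite semigroup [finite unary semigroup] is inherently nonfinitely based if it is not contained in any locally finite finitely based variety of semigroups [of unary semigroups]. The $3$-element twisted semilattice is $\mathcal{TSL}=\langle\{e,f,0\},\cdot,{}^*\rangle$, in which $e^2=e$, $f^2=f$, all other products equal $0$, and $e^*=f$, $f^*=e$, $0^*=0$. *)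

theory Defs
  imports "HOL-Algebra.Congruence" "HOL-Library.Countable_Set"
begin

record 'a sgrp = "'a partial_object" +
  sg_mult :: "'a \<Rightarrow> 'a \<Rightarrow> 'a"

record 'a usgrp = "'a sgrp" +
  sg_star :: "'a \<Rightarrow> 'a"

definition reduct :: "'a usgrp \<Rightarrow> 'a sgrp" where
  "reduct S = \<lparr>carrier = carrier S, sg_mult = sg_mult S\<rparr>"

definition is_semigroup :: "'a sgrp \<Rightarrow> bool" where
  "is_semigroup A \<longleftrightarrow> carrier A \<noteq> {} \<and>
     (\<forall>x\<in>carrier A. \<forall>y\<in>carrier A. sg_mult A x y \<in> carrier A) \<and>
     (\<forall>x\<in>carrier A. \<forall>y\<in>carrier A. \<forall>z\<in>carrier A.
        sg_mult A (sg_mult A x y) z = sg_mult A x (sg_mult A y z))"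

definition is_unary_semigroup :: "'a usgrp \<Rightarrow> bool" where
  "is_unary_semigroup S \<longleftrightarrow> is_semigroup (reduct S) \<and>
     (\<forall>x\<in>carrier S. sg_star S x \<in> carrier S)"

definition is_involutory_semigroup :: "'a usgrp \<Rightarrow> bool" where
  "is_involutory_semigroup S \<longleftrightarrow> is_unary_semigroup S \<and>
     (\<forall>x\<in>carrier S. \<forall>y\<in>carrier S.
        sg_star S (sg_mult S x y) = sg_mult S (sg_star S y) (sg_star S x)) \<and>
     (\<forall>x\<in>carrier S. sg_star S (sg_star S x) = x)"

text \<open>
  A set of identities over countably many variables stands for the variety it defines.
  Terms are not taken modulo associativity; associativity is instead part of membership in
  the variety, so a finite set of identities is a finite basis in either reading.
\<close>

datatype sg_term = SVar nat | SMul sg_term sg_term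

instance sg_term :: countable
  by countable_datatype

datatype usg_term = UVar nat | UMul usg_term usg_term | UStar usg_term

instance usg_term :: countable
  by countable_datatype

fun sg_eval :: "'a sgrp \<Rightarrow> (nat \<Rightarrow> 'a) \<Rightarrow> sg_term \<Rightarrow> 'a" where
  "sg_eval A v (SVar n) = v n"
| "sg_eval A v (SMul s t) = sg_mult A (sg_eval A v s) (sg_eval A v t)"

fun usg_eval :: "'a usgrp \<Rightarrow> (nat \<Rightarrow> 'a) \<Rightarrow> usg_term \<Rightarrow> 'a" where
  "usg_eval S v (UVar n) = v n"
| "usg_eval S v (UMul s t) = sg_mult S (usg_eval S v s) (usg_eval S v t)"
| "usg_eval S v (UStar t) = sg_star S (usg_eval S v t)"

definition sg_satisfies :: "'a sgrp \<Rightarrow> sg_term \<times> sg_term \<Rightarrow> bool" where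
  "sg_satisfies A p \<longleftrightarrow>
     (\<forall>v. range v \<subseteq> carrier A \<longrightarrow> sg_eval A v (fst p) = sg_eval A v (snd p))"

definition usg_satisfies :: "'a usgrp \<Rightarrow> usg_term \<times> usg_term \<Rightarrow> bool" where
  "usg_satisfies S p \<longleftrightarrow>
     (\<forall>v. range v \<subseteq> carrier S \<longrightarrow> usg_eval S v (fst p) = usg_eval S v (snd p))"

definition sg_variety :: "(sg_term \<times> sg_term) set \<Rightarrow> 'a sgrp set" where
  "sg_variety \<Sigma> = {A. is_semigroup A \<and> (\<forall>p\<in>\<Sigma>. sg_satisfies A p)}"

definition usg_variety :: "(usg_term \<times> usg_term) set \<Rightarrow> 'a usgrp set" where
  "usg_variety \<Sigma> = {S. is_unary_semigroup S \<and> (\<forall>p\<in>\<Sigma>. usg_satisfies S p)}"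

text \<open>
  The variety generated by \<open>S\<close> is the intersection of all varieties containing \<open>S\<close>; the types
  \<open>'a\<close> and \<open>'b\<close> are independent, so that members need not live in the type of \<open>S\<close>.
\<close>

definition usg_var :: "'a usgrp \<Rightarrow> 'b usgrp set" where
  "usg_var S = {T. \<forall>\<Sigma>. S \<in> usg_variety \<Sigma> \<longrightarrow> T \<in> usg_variety \<Sigma>}"

inductive_set sg_gen :: "'a sgrp \<Rightarrow> 'a set \<Rightarrow> 'a set" for A X where
  base: "x \<in> X \<Longrightarrow> x \<in> sg_gen A X"
| mult: "\<lbrakk>x \<in> sg_gen A X; y \<in> sg_gen A X\<rbrakk> \<Longrightarrow> sg_mult A x y \<in> sg_gen A X"

inductive_set usg_gen :: "'a usgrp \<Rightarrow> 'a set \<Rightarrow> 'a set" for S X where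
  base: "x \<in> X \<Longrightarrow> x \<in> usg_gen S X"
| mult: "\<lbrakk>x \<in> usg_gen S X; y \<in> usg_gen S X\<rbrakk> \<Longrightarrow> sg_mult S x y \<in> usg_gen S X"
| star: "x \<in> usg_gen S X \<Longrightarrow> sg_star S x \<in> usg_gen S X"

definition sg_finitely_generated :: "'a sgrp \<Rightarrow> bool" where
  "sg_finitely_generated A \<longleftrightarrow> (\<exists>X. finite X \<and> X \<subseteq> carrier A \<and> sg_gen A X = carrier A)"

definition usg_finitely_generated :: "'a usgrp \<Rightarrow> bool" where
  "usg_finitely_generated S \<longleftrightarrow> (\<exists>X. finite X \<and> X \<subseteq> carrier S \<and> usg_gen S X = carrier S)"

text \<open>
  HOL cannot quantify over all types. Finitely generated members are countable, hence
  isomorphic to algebras whose carrier is a set of natural numbers, so quantifying over the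
  latter suffices; the lemmas \<open>sg_locally_finiteD\<close> and \<open>usg_locally_finiteD\<close> below confirm
  this for members over an arbitrary type.
\<close>

definition sg_locally_finite :: "(sg_term \<times> sg_term) set \<Rightarrow> bool" where
  "sg_locally_finite \<Sigma> \<longleftrightarrow>
     (\<forall>A :: nat sgrp. A \<in> sg_variety \<Sigma> \<longrightarrow> sg_finitely_generated A \<longrightarrow> finite (carrier A))"

definition usg_locally_finite :: "(usg_term \<times> usg_term) set \<Rightarrow> bool" where
  "usg_locally_finite \<Sigma> \<longleftrightarrow>
     (\<forall>S :: nat usgrp. S \<in> usg_variety \<Sigma> \<longrightarrow> usg_finitely_generated S \<longrightarrow> finite (carrier S))"

lemma sg_finitely_generated_countable:
  assumes "sg_finitely_generated A" shows "countable (carrier A)"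
proof -
  obtain X where X: "finite X" "sg_gen A X = carrier A"
    using assms by (auto simp: sg_finitely_generated_def)
  let ?v = "from_nat_into X"
  have "x \<in> range (sg_eval A ?v)" if "x \<in> sg_gen A X" for x
    using that
  proof induction
    case (base x)
    then obtain n where "?v n = x"
      using X(1) by (metis countable_finite from_nat_into_surj)
    then have "x = sg_eval A ?v (SVar n)" by simp
    then show ?case by blast
  next
    case (mult x y)
    then obtain s t where "x = sg_eval A ?v s" "y = sg_eval A ?v t" by blast
    then have "sg_mult A x y = sg_eval A ?v (SMul s t)" by simp
    then show ?case by blast
  qed
  then have "carrier A \<subseteq> range (sg_eval A ?v)" using X by auto
  then show ?thesis by (rule countable_subset) auto
qed

lemma usg_finitely_generated_countable:
  assumes "usg_finitely_generated S" shows "countable (carrier S)"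
proof -
  obtain X where X: "finite X" "usg_gen S X = carrier S"
    using assms by (auto simp: usg_finitely_generated_def)
  let ?v = "from_nat_into X"
  have "x \<in> range (usg_eval S ?v)" if "x \<in> usg_gen S X" for x
    using that
  proof induction
    case (base x)
    then obtain n where "?v n = x"
      using X(1) by (metis countable_finite from_nat_into_surj)
    then have "x = usg_eval S ?v (UVar n)" by simp
    then show ?case by blast
  next
    case (mult x y)
    then obtain s t where "x = usg_eval S ?v s" "y = usg_eval S ?v t" by blast
    then have "sg_mult S x y = usg_eval S ?v (UMul s t)" by simp
    then show ?case by blast
  next
    case (star x)
    then obtain s where "x = usg_eval S ?v s" by blast
    then have "sg_star S x = usg_eval S ?v (UStar s)" by simp
    then show ?case by blast
  qed
  then have "carrier S \<subseteq> range (usg_eval S ?v)" using X by auto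
  then show ?thesis by (rule countable_subset) auto
qed

lemma sg_locally_finiteD:
  fixes A :: "'a sgrp"
  assumes lf: "sg_locally_finite \<Sigma>" and A: "A \<in> sg_variety \<Sigma>" and fg: "sg_finitely_generated A"
  shows "finite (carrier A)"
proof -
  define f where "f = to_nat_on (carrier A)"
  define g where "g = inv_into (carrier A) f"
  have inj: "inj_on f (carrier A)"
    unfolding f_def using sg_finitely_generated_countable[OF fg] by (rule inj_on_to_nat_on)
  have gf [simp]: "g (f x) = x" if "x \<in> carrier A" for x
    using that inj by (simp add: g_def)
  define B where "B = \<lparr>carrier = f ` carrier A, sg_mult = (\<lambda>m n. f (sg_mult A (g m) (g n)))\<rparr>"
  have B [simp]: "carrier B = f ` carrier A" "sg_mult B m n = f (sg_mult A (g m) (g n))" for m n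
    by (simp_all add: B_def)
  have sgA: "is_semigroup A" using A by (simp add: sg_variety_def)
  then have cl [simp]: "sg_mult A x y \<in> carrier A" if "x \<in> carrier A" "y \<in> carrier A" for x y
    using that by (simp add: is_semigroup_def)
  have sgB: "is_semigroup B" using sgA by (simp add: is_semigroup_def)
  have sat: "sg_satisfies B p" if "p \<in> \<Sigma>" for p
    unfolding sg_satisfies_def
  proof (intro allI impI)
    fix v :: "nat \<Rightarrow> nat" assume v: "range v \<subseteq> carrier B"
    have vg: "g (v n) \<in> carrier A" "f (g (v n)) = v n" for n
    proof -
      have "v n \<in> f ` carrier A" using v by auto
      then show "g (v n) \<in> carrier A" "f (g (v n)) = v n" by auto
    qed
    have ev: "sg_eval A (g \<circ> v) t \<in> carrier A \<and> sg_eval B v t = f (sg_eval A (g \<circ> v) t)" for t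
      by (induction t) (simp_all add: vg)
    have "sg_satisfies A p" using A that by (simp add: sg_variety_def)
    moreover have "range (g \<circ> v) \<subseteq> carrier A" using vg by auto
    ultimately have "sg_eval A (g \<circ> v) (fst p) = sg_eval A (g \<circ> v) (snd p)"
      unfolding sg_satisfies_def by blast
    then show "sg_eval B v (fst p) = sg_eval B v (snd p)" by (simp add: ev)
  qed
  obtain X where X: "finite X" "X \<subseteq> carrier A" "sg_gen A X = carrier A"
    using fg by (auto simp: sg_finitely_generated_def)
  have "f x \<in> sg_gen B (f ` X)" if "x \<in> sg_gen A X" for x
    using that
  proof induction
    case (mult x y)
    then have "sg_mult B (f x) (f y) \<in> sg_gen B (f ` X)" by (intro sg_gen.mult)
    then show ?case using mult.hyps X by simp
  qed (auto intro: sg_gen.base)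
  moreover have "y \<in> carrier B" if "y \<in> sg_gen B (f ` X)" for y
    using that by induction (use X in auto)
  ultimately have "sg_gen B (f ` X) = carrier B" using X by auto
  then have "sg_finitely_generated B"
    unfolding sg_finitely_generated_def using X by (intro exI[of _ "f ` X"]) auto
  then have "finite (carrier B)"
    using lf sgB sat by (auto simp: sg_locally_finite_def sg_variety_def simp del: B)
  then show ?thesis using inj by (simp add: finite_image_iff)
qed

lemma usg_locally_finiteD:
  fixes S :: "'a usgrp"
  assumes lf: "usg_locally_finite \<Sigma>" and S: "S \<in> usg_variety \<Sigma>" and fg: "usg_finitely_generated S"
  shows "finite (carrier S)"
proof -
  define f where "f = to_nat_on (carrier S)"
  define g where "g = inv_into (carrier S) f"
  have inj: "inj_on f (carrier S)"
    unfolding f_def using usg_finitely_generated_countable[OF fg] by (rule inj_on_to_nat_on)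
  have gf [simp]: "g (f x) = x" if "x \<in> carrier S" for x
    using that inj by (simp add: g_def)
  define T where "T = \<lparr>carrier = f ` carrier S, sg_mult = (\<lambda>m n. f (sg_mult S (g m) (g n))),
     sg_star = (\<lambda>m. f (sg_star S (g m)))\<rparr>"
  have T [simp]: "carrier T = f ` carrier S" "sg_mult T m n = f (sg_mult S (g m) (g n))"
    "sg_star T m = f (sg_star S (g m))" for m n
    by (simp_all add: T_def)
  have usgS: "is_unary_semigroup S" using S by (simp add: usg_variety_def)
  then have cl [simp]: "sg_mult S x y \<in> carrier S" if "x \<in> carrier S" "y \<in> carrier S" for x y
    using that by (simp add: is_unary_semigroup_def is_semigroup_def reduct_def)
  have cl' [simp]: "sg_star S x \<in> carrier S" if "x \<in> carrier S" for x
    using usgS that by (simp add: is_unary_semigroup_def)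
  have usgT: "is_unary_semigroup T"
    using usgS by (simp add: is_unary_semigroup_def is_semigroup_def reduct_def)
  have sat: "usg_satisfies T p" if "p \<in> \<Sigma>" for p
    unfolding usg_satisfies_def
  proof (intro allI impI)
    fix v :: "nat \<Rightarrow> nat" assume v: "range v \<subseteq> carrier T"
    have vg: "g (v n) \<in> carrier S" "f (g (v n)) = v n" for n
    proof -
      have "v n \<in> f ` carrier S" using v by auto
      then show "g (v n) \<in> carrier S" "f (g (v n)) = v n" by auto
    qed
    have ev: "usg_eval S (g \<circ> v) t \<in> carrier S \<and> usg_eval T v t = f (usg_eval S (g \<circ> v) t)" for t
      by (induction t) (simp_all add: vg)
    have "usg_satisfies S p" using S that by (simp add: usg_variety_def)
    moreover have "range (g \<circ> v) \<subseteq> carrier S" using vg by auto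
    ultimately have "usg_eval S (g \<circ> v) (fst p) = usg_eval S (g \<circ> v) (snd p)"
      unfolding usg_satisfies_def by blast
    then show "usg_eval T v (fst p) = usg_eval T v (snd p)" by (simp add: ev)
  qed
  obtain X where X: "finite X" "X \<subseteq> carrier S" "usg_gen S X = carrier S"
    using fg by (auto simp: usg_finitely_generated_def)
  have "f x \<in> usg_gen T (f ` X)" if "x \<in> usg_gen S X" for x
    using that
  proof induction
    case (mult x y)
    then have "sg_mult T (f x) (f y) \<in> usg_gen T (f ` X)" by (intro usg_gen.mult)
    then show ?case using mult.hyps X by simp
  next
    case (star x)
    then have "sg_star T (f x) \<in> usg_gen T (f ` X)" by (intro usg_gen.star)
    then show ?case using star.hyps X by simp
  qed (auto intro: usg_gen.base)
  moreover have "y \<in> carrier T" if "y \<in> usg_gen T (f ` X)" for y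
    using that by induction (use X in auto)
  ultimately have "usg_gen T (f ` X) = carrier T" using X by auto
  then have "usg_finitely_generated T"
    unfolding usg_finitely_generated_def using X by (intro exI[of _ "f ` X"]) auto
  then have "finite (carrier T)"
    using lf usgT sat by (auto simp: usg_locally_finite_def usg_variety_def simp del: T)
  then show ?thesis using inj by (simp add: finite_image_iff)
qed

text \<open>
  A finitely based variety is one of the form \<open>sg_variety \<Sigma>\<close> or \<open>usg_variety \<Sigma>\<close> with \<open>\<Sigma>\<close> finite.
  The notions are meant for finite (unary) semigroups only; finiteness is not part of the
  definitions.
\<close>

definition sg_inherently_nonfinitely_based :: "'a sgrp \<Rightarrow> bool" where
  "sg_inherently_nonfinitely_based A \<longleftrightarrow>
     \<not> (\<exists>\<Sigma>. finite \<Sigma> \<and> sg_locally_finite \<Sigma> \<and> A \<in> sg_variety \<Sigma>)"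

definition usg_inherently_nonfinitely_based :: "'a usgrp \<Rightarrow> bool" where
  "usg_inherently_nonfinitely_based S \<longleftrightarrow>
     \<not> (\<exists>\<Sigma>. finite \<Sigma> \<and> usg_locally_finite \<Sigma> \<and> S \<in> usg_variety \<Sigma>)"

datatype tsl = TE | TF | TZ

fun tsl_mult :: "tsl \<Rightarrow> tsl \<Rightarrow> tsl" where
  "tsl_mult TE TE = TE"
| "tsl_mult TF TF = TF"
| "tsl_mult _ _ = TZ"

fun tsl_star :: "tsl \<Rightarrow> tsl" where
  "tsl_star TE = TF"
| "tsl_star TF = TE"
| "tsl_star TZ = TZ"

definition TSL :: "tsl usgrp" where
  "TSL = \<lparr>carrier = UNIV, sg_mult = tsl_mult, sg_star = tsl_star\<rparr>"

end

theory Submission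
  imports Defs
begin

text \<open>
  The proof is by contraposition: from a finite basis \<open>\<Sigma>\<close> of a locally finite variety containing
  the involutory semigroup \<open>S\<close> one extracts a finite set of plain identities that hold in the
  reduct of \<open>S\<close> and again define a locally finite variety.

  In an involutory semigroup the stars of a term can be pushed down to the variables, so a term
  amounts to a word in literals \<open>x\<close> and \<open>x\<^sup>*\<close>.  Call it consistent if no variable contributes
  both of its literals.  Under the twisted semilattice, a word takes the value \<open>e\<close> exactly when
  all its literals do; hence an identity holding there has either the same
  set of literals on both sides or two inconsistent sides (lemma \<open>TSL_same_literals\<close>).  An
  identity with equal, consistent sets of literals becomes a plain identity when every starred
  variable is renamed to its star, and it holds in the reduct of \<open>S\<close>, as does the mirror image
  obtained by applying the star to both sides.  These plain identities and their mirror images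
  make up the set \<open>plain_part \<Sigma>\<close>.

  To see that \<open>plain_part \<Sigma>\<close> defines a locally finite variety, take a finitely generated semigroup
  \<open>A\<close> in it and let \<open>double A\<close> be the disjoint union of \<open>A\<close>, its opposite, and a zero, where
  products across the two copies are zero and the star swaps the copies.  Inconsistent words
  vanish in \<open>double A\<close>; a consistent word is nonzero only if all its literals lie in the same
  copy, and there the plain identities or their mirror images apply.  So \<open>double A\<close> satisfies
  \<open>\<Sigma>\<close> (lemma \<open>double_in_variety\<close>).  As it is finitely generated, it is finite, and so is \<open>A\<close>.
\<close>

text \<open>
  The Boolean argument records whether the subterm is under an odd number of stars.  Pushing these
  stars inwards reverses products, so \<open>unstarred True t\<close> is the mirror image of
  \<open>unstarred False t\<close>.
\<close>

fun unstarred :: "bool \<Rightarrow> usg_term \<Rightarrow> sg_term" where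
  "unstarred b (UVar n) = SVar n"
| "unstarred b (UMul s t) =
     (if b then SMul (unstarred b t) (unstarred b s) else SMul (unstarred b s) (unstarred b t))"
| "unstarred b (UStar t) = unstarred (\<not> b) t"

fun literals :: "bool \<Rightarrow> usg_term \<Rightarrow> (nat \<times> bool) set" where
  "literals b (UVar n) = {(n, b)}"
| "literals b (UMul s t) = literals b s \<union> literals b t"
| "literals b (UStar t) = literals (\<not> b) t"

definition consistent :: "(nat \<times> bool) set \<Rightarrow> bool" where
  "consistent L \<longleftrightarrow> (\<forall>n. \<not> ((n, False) \<in> L \<and> (n, True) \<in> L))"

definition plain_part :: "(usg_term \<times> usg_term) set \<Rightarrow> (sg_term \<times> sg_term) set" where
  "plain_part \<Sigma> = {(unstarred b s, unstarred b t) | b s t. (s, t) \<in> \<Sigma> \<and> consistent (literals b s)}"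

lemma finite_plain_part:
  assumes "finite \<Sigma>"
  shows "finite (plain_part \<Sigma>)"
proof (rule finite_subset)
  show "plain_part \<Sigma> \<subseteq> (\<lambda>(b, s, t). (unstarred b s, unstarred b t)) ` (UNIV \<times> \<Sigma>)"
    unfolding plain_part_def by force
  show "finite ((\<lambda>(b, s, t). (unstarred b s, unstarred b t)) ` (UNIV \<times> \<Sigma>))"
    using assms by simp
qed

lemma consistentE:
  assumes "consistent L"
  obtains c where "\<And>n d. (n, d) \<in> L \<Longrightarrow> c n = d"
proof
  fix n d assume "(n, d) \<in> L"
  then show "((n, True) \<in> L) = d"
    using assms by (cases d) (auto simp: consistent_def)
qed


section \<open>Identities of the twisted semilattice\<close>

definition TSL_unit :: "bool \<Rightarrow> tsl" where
  "TSL_unit b = (if b then TF else TE)"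

lemma TSL_unit_inject [simp]: "TSL_unit b = TSL_unit c \<longleftrightarrow> b = c"
  by (simp add: TSL_unit_def)

lemma TSL_unit_neq_zero [simp]: "TZ \<noteq> TSL_unit b"
  by (simp add: TSL_unit_def)

lemma tsl_mult_eq_unit: "tsl_mult x y = TSL_unit b \<longleftrightarrow> x = TSL_unit b \<and> y = TSL_unit b"
  by (cases x; cases y) (auto simp: TSL_unit_def)

lemma tsl_star_eq_unit: "tsl_star x = TSL_unit b \<longleftrightarrow> x = TSL_unit (\<not> b)"
  by (cases x) (auto simp: TSL_unit_def)

lemma TSL_eval_eq_unit:
  "usg_eval TSL v t = TSL_unit b \<longleftrightarrow> (\<forall>(n, d) \<in> literals b t. v n = TSL_unit d)"
  by (induction t arbitrary: b)
    (simp_all add: TSL_def tsl_mult_eq_unit tsl_star_eq_unit ball_Un)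

text \<open>
  The assignment that sends all literals of \<open>s\<close> to the same idempotent, and every variable not
  occurring in \<open>s\<close> to zero, detects each literal of \<open>t\<close> that does not occur in \<open>s\<close>.
\<close>

lemma TSL_literals_subset:
  assumes "usg_satisfies TSL (s, t)" and "consistent (literals b s)"
  shows "literals b t \<subseteq> literals b s"
proof
  fix l assume l: "l \<in> literals b t"
  obtain c where c: "\<And>n d. (n, d) \<in> literals b s \<Longrightarrow> c n = d"
    using consistentE[OF assms(2)] by blast
  define v where "v n = (if (n, c n) \<in> literals b s then TSL_unit (c n) else TZ)" for n
  have "usg_eval TSL v s = TSL_unit b"
    unfolding TSL_eval_eq_unit v_def using c by auto
  moreover have "usg_eval TSL v s = usg_eval TSL v t"
    using assms(1) by (simp add: usg_satisfies_def TSL_def)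
  ultimately have "\<forall>(n, d) \<in> literals b t. v n = TSL_unit d"
    using TSL_eval_eq_unit by metis
  then show "l \<in> literals b s"
    using l by (cases l) (auto simp: v_def split: if_splits)
qed

lemma usg_satisfies_sym: "usg_satisfies S (s, t) \<Longrightarrow> usg_satisfies S (t, s)"
  by (simp add: usg_satisfies_def)

lemma TSL_same_literals:
  assumes "usg_satisfies TSL (s, t)" and "consistent (literals b s)"
  shows "literals b t = literals b s"
proof
  show sub: "literals b t \<subseteq> literals b s"
    using assms by (rule TSL_literals_subset)
  then have "consistent (literals b t)"
    using assms(2) by (auto simp: consistent_def)
  then show "literals b s \<subseteq> literals b t"
    using TSL_literals_subset[OF usg_satisfies_sym[OF assms(1)]] by blast
qed


section \<open>Plain identities of the reduct\<close>

text \<open>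
  Once the stars of \<open>t\<close> (of its star, if \<open>b\<close>) have been pushed down to the variables, \<open>c\<close> tells
  which variables are starred.  Replacing exactly these by their stars cancels all the stars.
\<close>

lemma eval_unstarred:
  fixes S :: "'a usgrp"
  assumes S: "is_involutory_semigroup S"
    and v: "range v \<subseteq> carrier S"
    and c: "\<And>n d. (n, d) \<in> literals b t \<Longrightarrow> c n = d"
  defines "w \<equiv> \<lambda>n. if c n then sg_star S (v n) else v n"
  shows "sg_eval (reduct S) v (unstarred b t) =
     (if b then sg_star S (usg_eval S w t) else usg_eval S w t)"
  using c
proof (induction t arbitrary: b)
  have vc: "v n \<in> carrier S" for n
    using v by auto
  have inv [simp]: "sg_star S (sg_star S x) = x" if "x \<in> carrier S" for x
    using S that by (simp add: is_involutory_semigroup_def)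
  have mult_closed: "sg_mult S x y \<in> carrier S" if "x \<in> carrier S" "y \<in> carrier S" for x y
    using S that
    by (simp add: is_involutory_semigroup_def is_unary_semigroup_def is_semigroup_def reduct_def)
  have star_closed: "sg_star S x \<in> carrier S" if "x \<in> carrier S" for x
    using S that by (simp add: is_involutory_semigroup_def is_unary_semigroup_def)
  have ev: "usg_eval S w t \<in> carrier S" for t
    by (induction t) (simp_all add: w_def vc mult_closed star_closed)
  {
    case (UVar n)
    then show ?case using vc by (simp add: w_def)
  next
    case (UMul s t)
    have "sg_star S (sg_mult S (usg_eval S w s) (usg_eval S w t)) =
        sg_mult S (sg_star S (usg_eval S w t)) (sg_star S (usg_eval S w s))"
      using S ev by (simp add: is_involutory_semigroup_def)
    then show ?case
      using UMul.IH[of b] UMul.prems by (cases b) (simp_all add: reduct_def)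
  next
    case (UStar t)
    then show ?case using UStar.IH[of "\<not> b"] ev by simp
  }
qed

lemma reduct_in_plain_variety:
  fixes S :: "'a usgrp"
  assumes S: "is_involutory_semigroup S" "S \<in> usg_variety \<Sigma>"
    and TSL: "TSL \<in> usg_variety \<Sigma>"
  shows "reduct S \<in> sg_variety (plain_part \<Sigma>)"
proof -
  have "sg_satisfies (reduct S) (unstarred b s, unstarred b t)"
    if st: "(s, t) \<in> \<Sigma>" and cons: "consistent (literals b s)" for b s t
    unfolding sg_satisfies_def fst_conv snd_conv
  proof (intro allI impI)
    fix v :: "nat \<Rightarrow> 'a" assume "range v \<subseteq> carrier (reduct S)"
    then have v: "range v \<subseteq> carrier S" by (simp add: reduct_def)
    obtain c where c: "\<And>n d. (n, d) \<in> literals b s \<Longrightarrow> c n = d"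
      using consistentE[OF cons] by blast
    have "literals b t = literals b s"
      using TSL st cons by (intro TSL_same_literals) (auto simp: usg_variety_def)
    then have c': "\<And>n d. (n, d) \<in> literals b t \<Longrightarrow> c n = d"
      using c by simp
    define w where "w = (\<lambda>n. if c n then sg_star S (v n) else v n)"
    have "w n \<in> carrier S" for n
    proof -
      have "v n \<in> carrier S" using v by blast
      then show ?thesis
        using S(1) by (simp add: w_def is_involutory_semigroup_def is_unary_semigroup_def)
    qed
    then have "range w \<subseteq> carrier S" by blast
    then have "usg_eval S w s = usg_eval S w t"
      using S(2) st unfolding usg_variety_def usg_satisfies_def by fastforce
    then show "sg_eval (reduct S) v (unstarred b s) = sg_eval (reduct S) v (unstarred b t)"
      using eval_unstarred[OF S(1) v c] eval_unstarred[OF S(1) v c']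
      by (simp add: w_def)
  qed
  then show ?thesis
    using S(1)
    by (auto simp: sg_variety_def plain_part_def is_involutory_semigroup_def is_unary_semigroup_def)
qed


section \<open>Doubling a semigroup\<close>

text \<open>
  \<open>Some (False, x)\<close> is the element \<open>x\<close> of \<open>A\<close>, \<open>Some (True, x)\<close> its copy in the opposite semigroup
  and \<open>None\<close> the zero.  The double of the trivial semigroup is the twisted semilattice.
\<close>

fun double_mult :: "'a sgrp \<Rightarrow> (bool \<times> 'a) option \<Rightarrow> (bool \<times> 'a) option \<Rightarrow> (bool \<times> 'a) option" where
  "double_mult A (Some (b, x)) (Some (c, y)) =
     (if b = c then Some (b, if b then sg_mult A y x else sg_mult A x y) else None)"
| "double_mult A _ _ = None"

definition double :: "'a sgrp \<Rightarrow> (bool \<times> 'a) option usgrp" where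
  "double A = \<lparr>carrier = insert None (Some ` (UNIV \<times> carrier A)),
     sg_mult = double_mult A, sg_star = map_option (map_prod Not id)\<rparr>"

lemma double_simps [simp]:
  "carrier (double A) = insert None (Some ` (UNIV \<times> carrier A))"
  "sg_mult (double A) = double_mult A"
  "sg_star (double A) = map_option (map_prod Not id)"
  by (simp_all add: double_def)

lemma double_mult_eq_Some:
  "double_mult A p q = Some (b, z) \<longleftrightarrow>
     (\<exists>x y. p = Some (b, x) \<and> q = Some (b, y) \<and> z = (if b then sg_mult A y x else sg_mult A x y))"
  by (cases "(A, p, q)" rule: double_mult.cases) auto

lemma double_is_unary_semigroup:
  assumes "is_semigroup A"
  shows "is_unary_semigroup (double A)"
proof -
  have closed: "sg_mult A x y \<in> carrier A" if "x \<in> carrier A" "y \<in> carrier A" for x y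
    using assms that by (simp add: is_semigroup_def)
  have assoc: "sg_mult A (sg_mult A x y) z = sg_mult A x (sg_mult A y z)"
    if "x \<in> carrier A" "y \<in> carrier A" "z \<in> carrier A" for x y z
    using assms that by (simp add: is_semigroup_def)
  show ?thesis
    by (auto simp: is_unary_semigroup_def is_semigroup_def reduct_def closed assoc)
qed

lemma double_eval_nonzero:
  assumes "\<And>n d. (n, d) \<in> literals b t \<Longrightarrow> v n = Some (d, a n)"
  shows "usg_eval (double A) v t = Some (b, sg_eval A a (unstarred b t))"
  using assms
proof (induction t arbitrary: b)
  case (UMul s t)
  have "usg_eval (double A) v s = Some (b, sg_eval A a (unstarred b s))"
    by (rule UMul.IH, rule UMul.prems) simp
  moreover have "usg_eval (double A) v t = Some (b, sg_eval A a (unstarred b t))"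
    by (rule UMul.IH, rule UMul.prems) simp
  ultimately show ?case by simp
next
  case (UStar t)
  have "usg_eval (double A) v t = Some (\<not> b, sg_eval A a (unstarred (\<not> b) t))"
    by (rule UStar.IH, rule UStar.prems) simp
  then show ?case by simp
qed simp

lemma double_eval_nonzeroD:
  assumes "usg_eval (double A) v t = Some (b, x)" and "(n, d) \<in> literals b t"
  shows "\<exists>y. v n = Some (d, y)"
  using assms
proof (induction t arbitrary: b x)
  case (UMul s t)
  then obtain y z where "usg_eval (double A) v s = Some (b, y)" "usg_eval (double A) v t = Some (b, z)"
    by (auto simp: double_mult_eq_Some)
  then show ?case using UMul.IH UMul.prems(2) by auto
next
  case (UStar t)
  then have "usg_eval (double A) v t = Some (\<not> b, x)" by auto
  then show ?case using UStar.IH UStar.prems(2) by simp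
qed auto

text \<open>
  This is the case of a nonzero side \<open>s\<close>: then \<open>v\<close> places all literals of \<open>s\<close> in the copy of \<open>A\<close>
  indexed by \<open>b\<close>.  Since \<open>t\<close> has the same literals, both sides are evaluated inside that copy.
\<close>

lemma double_eval_transfer:
  assumes A: "A \<in> sg_variety (plain_part \<Sigma>)"
    and st: "(s, t) \<in> \<Sigma>" and TSL: "usg_satisfies TSL (s, t)"
    and v: "range v \<subseteq> carrier (double A)"
    and consistent: "consistent (literals b s)"
    and copy: "\<And>n d. (n, d) \<in> literals b s \<Longrightarrow> \<exists>y. v n = Some (d, y)"
  shows "usg_eval (double A) v s = usg_eval (double A) v t"
proof -
  have same: "literals b t = literals b s"
    using TSL consistent by (rule TSL_same_literals)
  obtain z where z: "z \<in> carrier A"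
    using A by (auto simp: sg_variety_def is_semigroup_def)
  \<comment> \<open>Variables sent to zero occur in neither side, so any element of \<open>A\<close> will do for them.\<close>
  define a where "a n = (case v n of None \<Rightarrow> z | Some p \<Rightarrow> snd p)" for n
  have lit: "v n = Some (d, a n)" if "(n, d) \<in> literals b s" for n d
    using copy[OF that] by (auto simp: a_def)
  have "a n \<in> carrier A" for n
  proof -
    have "v n \<in> carrier (double A)" using v by blast
    then show ?thesis using z by (auto simp: a_def)
  qed
  moreover have "sg_satisfies A (unstarred b s, unstarred b t)"
    using A st consistent unfolding sg_variety_def plain_part_def by blast
  ultimately have "sg_eval A a (unstarred b s) = sg_eval A a (unstarred b t)"
    by (simp add: sg_satisfies_def image_subset_iff)
  moreover have "usg_eval (double A) v s = Some (b, sg_eval A a (unstarred b s))"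
    using lit by (rule double_eval_nonzero)
  moreover have "usg_eval (double A) v t = Some (b, sg_eval A a (unstarred b t))"
    using lit same by (intro double_eval_nonzero) simp
  ultimately show ?thesis by simp
qed

lemma double_in_variety:
  assumes A: "A \<in> sg_variety (plain_part \<Sigma>)" and TSL: "TSL \<in> usg_variety \<Sigma>"
  shows "double A \<in> usg_variety \<Sigma>"
proof -
  have "usg_eval (double A) v s = usg_eval (double A) v t"
    if st: "(s, t) \<in> \<Sigma>" and v: "range v \<subseteq> carrier (double A)" for s t v
  proof -
    have TSL_st: "usg_satisfies TSL (s, t)"
      using TSL st by (auto simp: usg_variety_def)
    have consistent: "consistent (literals b r)"
      if "usg_eval (double A) v r = Some (b, x)" for r b x
      unfolding consistent_def
      using double_eval_nonzeroD[OF that, of _ False] double_eval_nonzeroD[OF that, of _ True]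
      by fastforce
    consider "usg_eval (double A) v s = None" "usg_eval (double A) v t = None"
      | b x where "usg_eval (double A) v s = Some (b, x)"
      | b x where "usg_eval (double A) v t = Some (b, x)"
      by (metis not_None_eq surj_pair)
    then show ?thesis
    proof cases
      case 1
      then show ?thesis by simp
    next
      case 2
      show ?thesis
      proof (rule double_eval_transfer[OF A st TSL_st v])
        show "consistent (literals b s)"
          using 2 by (rule consistent)
        show "\<exists>y. v n = Some (d, y)" if "(n, d) \<in> literals b s" for n d
          using 2 that by (rule double_eval_nonzeroD)
      qed
    next
      case 3
      have "consistent (literals b t)"
        using 3 by (rule consistent)
      with usg_satisfies_sym[OF TSL_st] have same: "literals b s = literals b t"
        by (rule TSL_same_literals)
      show ?thesis
      proof (rule double_eval_transfer[OF A st TSL_st v])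
        show "consistent (literals b s)"
          unfolding same using 3 by (rule consistent)
        show "\<exists>y. v n = Some (d, y)" if "(n, d) \<in> literals b s" for n d
          using 3 that[unfolded same] by (rule double_eval_nonzeroD)
      qed
    qed
  qed
  then show ?thesis
    using A by (auto simp: usg_variety_def usg_satisfies_def sg_variety_def double_is_unary_semigroup)
qed

lemma double_finitely_generated:
  assumes A: "is_semigroup A" and fg: "sg_finitely_generated A"
  shows "usg_finitely_generated (double A)"
proof -
  obtain X where X: "finite X" "X \<subseteq> carrier A" "sg_gen A X = carrier A"
    using fg by (auto simp: sg_finitely_generated_def)
  define Y where "Y = (\<lambda>x. Some (False, x)) ` X"
  have pos: "Some (False, x) \<in> usg_gen (double A) Y" if "x \<in> sg_gen A X" for x
    using that
  proof induction
    case (base x)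
    then show ?case by (auto simp: Y_def intro: usg_gen.base)
  next
    case (mult x y)
    then show ?case using usg_gen.mult[OF mult.IH] by simp
  qed
  have neg: "Some (True, x) \<in> usg_gen (double A) Y" if "x \<in> sg_gen A X" for x
    using usg_gen.star[OF pos[OF that]] by simp
  obtain z where "z \<in> carrier A"
    using A by (auto simp: is_semigroup_def)
  then have zero: "None \<in> usg_gen (double A) Y"
    using usg_gen.mult[OF pos neg, of z z] X by simp
  have "p \<in> carrier (double A)" if "p \<in> usg_gen (double A) Y" for p
    using that
  proof induction
    case (base p)
    then show ?case using X by (auto simp: Y_def)
  qed (use double_is_unary_semigroup[OF A] in
        \<open>auto simp: is_unary_semigroup_def is_semigroup_def reduct_def simp del: double_simps\<close>)
  moreover have "p \<in> usg_gen (double A) Y" if "p \<in> carrier (double A)" for p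
  proof -
    have "Some (b, x) \<in> usg_gen (double A) Y" if "x \<in> carrier A" for b x
      using that pos neg X(3) by (cases b) simp_all
    then show ?thesis using that zero by auto
  qed
  ultimately have "usg_gen (double A) Y = carrier (double A)" by blast
  moreover have "finite Y" "Y \<subseteq> carrier (double A)"
    using X by (auto simp: Y_def)
  ultimately show ?thesis
    unfolding usg_finitely_generated_def by blast
qed

lemma plain_part_locally_finite:
  assumes lf: "usg_locally_finite \<Sigma>" and TSL: "TSL \<in> usg_variety \<Sigma>"
  shows "sg_locally_finite (plain_part \<Sigma>)"
  unfolding sg_locally_finite_def
proof (intro allI impI)
  fix A :: "nat sgrp"
  assume A: "A \<in> sg_variety (plain_part \<Sigma>)" and fg: "sg_finitely_generated A"
  then have "is_semigroup A" by (simp add: sg_variety_def)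
  then have "finite (carrier (double A))"
    using usg_locally_finiteD[OF lf double_in_variety[OF A TSL]] double_finitely_generated fg
    by blast
  moreover have "(\<lambda>x. Some (False, x)) ` carrier A \<subseteq> carrier (double A)" by auto
  ultimately have "finite ((\<lambda>x. Some (False, x)) ` carrier A)"
    by (rule finite_subset[rotated])
  then show "finite (carrier A)"
    by (rule finite_imageD) (simp add: inj_on_def)
qed

theorem theorem3p1:
  fixes S :: "'a usgrp"
  assumes "is_involutory_semigroup S"
    and "finite (carrier S)"
    and "TSL \<in> usg_var S"
    and "sg_inherently_nonfinitely_based (reduct S)"
  shows "usg_inherently_nonfinitely_based S"
  unfolding usg_inherently_nonfinitely_based_def
proof
  assume "\<exists>\<Sigma>. finite \<Sigma> \<and> usg_locally_finite \<Sigma> \<and> S \<in> usg_variety \<Sigma>"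
  then obtain \<Sigma> where \<Sigma>: "finite \<Sigma>" "usg_locally_finite \<Sigma>" "S \<in> usg_variety \<Sigma>"
    by blast
  then have TSL: "TSL \<in> usg_variety \<Sigma>"
    using assms(3) by (simp add: usg_var_def)
  have "finite (plain_part \<Sigma>)"
    using \<Sigma>(1) by (rule finite_plain_part)
  moreover have "sg_locally_finite (plain_part \<Sigma>)"
    using \<Sigma>(2) TSL by (rule plain_part_locally_finite)
  moreover have "reduct S \<in> sg_variety (plain_part \<Sigma>)"
    using assms(1) \<Sigma>(3) TSL by (rule reduct_in_plain_variety)
  ultimately show False
    using assms(4) unfolding sg_inherently_nonfinitely_based_def by blast
qed

end
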